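(* If $2<p<\infty$, then $$\mathcal{L}\colon L^p(\mathbb{R}_+,x^{p-2}\,dx)\to H^p(\mathbb{C}_+)$$ is bounded, i.e. there is a constant $C>0$ such that $\mathcal{L}f\in H^p(\mathbb{C}_+)$ and $\|\mathcal{L}f\|_{H^p(\mathbb{C}_+)}\le C\left(\int_0^\infty|f(x)|^px^{p-2}\,dx\right)^{1/p}$ for all $f\in L^p(\mathbb{R}_+,x^{p-2}\,dx)$.
   Context: $\mathbb{R}_+=(0,\infty)$ and $\mathbb{C}_+=\{z\in\mathbb{C}:\operatorname{Im}z>0\}$. The Laplace transform is $\mathcal{L}f(z)=\int_0^\infty f(t)e^{2\pi i tz}\,dt$ for $z\in\mathbb{C}_+$. The Hardy space $H^p(\mathbb{C}_+)$ is the space of analytic functions $F\colon\mathbb{C}_+\to\mathbb{C}$ such that $\|F\|_{H^p(\mathbb{C}_+)}:=\sup_{y>0}\left(\int_{\mathbb{R}}|F(x+iy)|^p\,dx\right)^{1/p}<\infty$. *)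

theory Defs
  imports "HOL-Complex_Analysis.Complex_Analysis"
begin

(* Real powers on [0, \<infinity>]; only used with a positive exponent, for which \<infinity> to the power a is \<infinity>. *)
definition ennreal_powr :: "ennreal \<Rightarrow> real \<Rightarrow> ennreal" where
  "ennreal_powr x a = (if x = \<infinity> then \<infinity> else ennreal (enn2real x powr a))"

(* The L^p norm takes values in [0, \<infinity>], so that finiteness is an honest condition. Elements of
   L^p are represented by functions rather than by classes modulo null sets. *)
definition Lp_norm :: "real \<Rightarrow> 'a measure \<Rightarrow> ('a \<Rightarrow> complex) \<Rightarrow> ennreal" where
  "Lp_norm p M f = ennreal_powr (\<integral>\<^sup>+ x. ennreal (norm (f x) powr p) \<partial>M) (1 / p)"

definition Lp_space :: "real \<Rightarrow> 'a measure \<Rightarrow> ('a \<Rightarrow> complex) set" where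
  "Lp_space p M = {f \<in> borel_measurable M. Lp_norm p M f < \<infinity>}"

definition power_weight :: "real \<Rightarrow> real measure" where
  "power_weight a = density (lebesgue_on {0<..}) (\<lambda>x. ennreal (x powr a))"

definition upper_half_plane :: "complex set" where
  "upper_half_plane = {z. Im z > 0}"

definition laplace_kernel :: "complex \<Rightarrow> real \<Rightarrow> complex" where
  "laplace_kernel z t = exp (2 * of_real pi * \<i> * of_real t * z)"

(* The Bochner integral is 0 where the integrand is not integrable, so statements about this
   transform should be accompanied by integrability of the integrand. *)
definition laplace :: "(real \<Rightarrow> complex) \<Rightarrow> complex \<Rightarrow> complex" where
  "laplace f z = (\<integral> t. f t * laplace_kernel z t \<partial>(lebesgue_on {0<..}))"

definition hardy_norm :: "real \<Rightarrow> (complex \<Rightarrow> complex) \<Rightarrow> ennreal" where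
  "hardy_norm p F = (SUP y\<in>{0<..}. Lp_norm p lebesgue (\<lambda>x. F (Complex x y)))"

(* Functions on the upper half-plane are total functions whose values elsewhere are irrelevant. *)
definition hardy_space :: "real \<Rightarrow> (complex \<Rightarrow> complex) set" where
  "hardy_space p = {F. F holomorphic_on upper_half_plane \<and> hardy_norm p F < \<infinity>}"

end

theory Submission
  imports Defs "HOL-Probability.Characteristic_Functions"
begin

text \<open>
  Fix \<open>y > 0\<close> and put \<open>h(t) = f(t) exp(- 2 \<pi> y t)\<close>, so that \<open>x \<mapsto> \<L>f(x + i y)\<close> is the Fourier transform
  of \<open>h\<close>. Let \<open>G(t)\<close> be the integral of \<open>|h|\<close> over \<open>(0, t)\<close>. For each level \<open>\<lambda>\<close> split \<open>h\<close> at the point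
  where \<open>2 G\<close> passes \<open>\<lambda>\<close>: the transform of the first piece is at most \<open>\<lambda> / 2\<close> everywhere, and the
  second piece is controlled by Plancherel and Chebyshev. Integrating over \<open>\<lambda>\<close> bounds the \<open>p\<close>-th power
  of the \<open>L\<^sup>p\<close> norm by a multiple of the integral of \<open>|h|\<^sup>2 G\<^bsup>p-2\<^esup>\<close>. Pointwise, \<open>|h|\<^sup>2 G\<^bsup>p-2\<^esup>\<close> is at most
  \<open>|h|\<^sup>p t\<^bsup>p-2\<^esup> + G\<^sup>p t\<^bsup>-2\<^esup>\<close>, and Hardy's inequality handles the second summand.
\<close>

section \<open>The Plancherel inequality\<close>

text \<open>This is the characteristic function of the standard normal distribution after the
  substitution \<open>x \<mapsto> a * x\<close>, with the normalising factor moved to the other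
  side.\<close>

lemma gaussian_fourier:
  fixes a w :: real
  assumes "a > 0"
  shows "(\<integral>x. exp (- (a * x)\<^sup>2 / 2) * cis (w * x) \<partial>lborel) = of_real (sqrt (2 * pi) / a * exp (- (w / a)\<^sup>2 / 2))"
proof -
  have "of_real (exp (- ((w / a)\<^sup>2) / 2)) = (\<integral>x. iexp (w / a * x) \<partial>density lborel std_normal_density)"
    using char_std_normal_distribution by (metis char_def)
  also have "\<dots> = (\<integral>x. std_normal_density x *\<^sub>R iexp (w / a * x) \<partial>lborel)"
    by (subst integral_density) auto
  also have "\<dots> = a *\<^sub>R (\<integral>x. std_normal_density (0 + a * x) *\<^sub>R iexp (w / a * (0 + a * x)) \<partial>lborel)"
    using assms by (subst lborel_integral_real_affine[where c = a and t = 0]) auto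
  also have "(\<lambda>x. std_normal_density (0 + a * x) *\<^sub>R iexp (w / a * (0 + a * x)))
      = (\<lambda>x. complex_of_real (1 / sqrt (2 * pi)) * (exp (- (a * x)\<^sup>2 / 2) * cis (w * x)))"
    using assms by (auto simp: std_normal_density_def cis_conv_exp scaleR_conv_of_real exp_of_real)
  also have "(\<integral>x. \<dots> x \<partial>lborel) = complex_of_real (1 / sqrt (2 * pi)) * (\<integral>x. exp (- (a * x)\<^sup>2 / 2) * cis (w * x) \<partial>lborel)"
    by (rule integral_mult_right_zero)
  finally show ?thesis
    using assms by (simp add: field_simps scaleR_conv_of_real)
qed

text \<open>The same substitution, applied to the total mass 1 of the normal density. The value in
  \<open>ennreal\<close> yields both integrability of the Gaussian and the normalisation of its
  transform.\<close>

lemma gaussian_nn_integral: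
  fixes a :: real
  assumes "a > 0"
  shows "(\<integral>\<^sup>+x. ennreal (exp (- (a * x)\<^sup>2 / 2)) \<partial>lborel) = ennreal (sqrt (2 * pi) / a)"
proof -
  have "1 = (\<integral>\<^sup>+x. std_normal_density x \<partial>lborel)"
    using prob_space.emeasure_space_1[OF prob_space_normal_density[of 1 0]]
    by (simp add: emeasure_density)
  also have "\<dots> = a * (\<integral>\<^sup>+x. std_normal_density (0 + a * x) \<partial>lborel)"
    using assms by (subst nn_integral_real_affine[where c = a and t = 0]) auto
  also have "(\<lambda>x. ennreal (std_normal_density (0 + a * x))) = (\<lambda>x. ennreal (1 / sqrt (2 * pi)) * ennreal (exp (- (a * x)\<^sup>2 / 2)))"
    by (auto simp: std_normal_density_def ennreal_mult'[symmetric])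
  also have "(\<integral>\<^sup>+x. \<dots> x \<partial>lborel) = ennreal (1 / sqrt (2 * pi)) * (\<integral>\<^sup>+x. ennreal (exp (- (a * x)\<^sup>2 / 2)) \<partial>lborel)"
    by (rule nn_integral_cmult) auto
  finally have "1 = ennreal (a / sqrt (2 * pi)) * (\<integral>\<^sup>+x. ennreal (exp (- (a * x)\<^sup>2 / 2)) \<partial>lborel)"
    using assms by (simp add: mult.assoc[symmetric] ennreal_mult'[symmetric])
  then have "ennreal (sqrt (2 * pi) / a) * 1 = ennreal (sqrt (2 * pi) / a) * (ennreal (a / sqrt (2 * pi)) * (\<integral>\<^sup>+x. ennreal (exp (- (a * x)\<^sup>2 / 2)) \<partial>lborel))"
    by simp
  then show ?thesis using assms
    by (simp add: mult.assoc[symmetric] ennreal_mult'[symmetric])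
qed

text \<open>If \<open>f\<close> is not integrable, its Bochner integral is 0 by convention, so norms
  can be moved inside without first checking integrability.\<close>

lemma ennreal_norm_integral_le:
  fixes f :: "'a \<Rightarrow> 'b::{banach, second_countable_topology}"
  shows "ennreal (norm (\<integral>x. f x \<partial>M)) \<le> (\<integral>\<^sup>+x. ennreal (norm (f x)) \<partial>M)"
  by (cases "integrable M f") (auto simp: integral_norm_bound_ennreal not_integrable_integral_eq)

text \<open>The positive sign in the exponent matches \<open>laplace_kernel\<close>: on a horizontal
  line the Laplace transform is \<open>fourier\<close> of an exponentially damped function.\<close>

definition fourier :: "(real \<Rightarrow> complex) \<Rightarrow> real \<Rightarrow> complex" where
  "fourier g x = (\<integral>t. g t * cis (2 * pi * t * x) \<partial>lborel)"

lemma borel_measurable_cis [measurable]: "cis \<in> borel_measurable borel"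
  by (intro borel_measurable_continuous_onI continuous_intros)

lemma fourier_measurable [measurable]:
  assumes [measurable]: "g \<in> borel_measurable borel"
  shows "fourier g \<in> borel_measurable borel"
  unfolding fourier_def by measurable

lemma fourier_bound:
  assumes "integrable lborel g"
  shows "norm (fourier g x) \<le> (\<integral>t. norm (g t) \<partial>lborel)"
  unfolding fourier_def by (rule order_trans[OF integral_norm_bound]) (simp add: norm_mult)

lemma integrable_fourier_integrand:
  assumes "integrable lborel g"
  shows "integrable lborel (\<lambda>t. g t * cis (2 * pi * t * x))"
proof -
  have [measurable]: "g \<in> borel_measurable borel" using assms by auto
  show ?thesis by (rule Bochner_Integration.integrable_bound[OF assms]) (auto simp: norm_mult)
qed

lemma fourier_add:
  assumes "integrable lborel g" "integrable lborel h"
  shows "fourier (\<lambda>t. g t + h t) x = fourier g x + fourier h x"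
  unfolding fourier_def using assms
  by (simp add: distrib_right integrable_fourier_integrand)

text \<open>Both exchanges of Bochner integrals in the Plancherel argument have integrands of this
  shape, with \<open>b\<close> a product of values of \<open>cis\<close>. The bound on
  \<open>b\<close> reduces the claim to the product of two integrable functions.\<close>

lemma integrable_pair_mult:
  fixes u v :: "real \<Rightarrow> complex" and b :: "real \<times> real \<Rightarrow> complex"
  assumes u: "integrable lborel u" and v: "integrable lborel v"
    and [measurable]: "b \<in> borel_measurable (lborel \<Otimes>\<^sub>M lborel)" and b: "\<And>z. norm (b z) \<le> 1"
  shows "integrable (lborel \<Otimes>\<^sub>M lborel) (\<lambda>(x, y). u x * v y * b (x, y))"
proof -
  have [measurable]: "u \<in> borel_measurable borel" "v \<in> borel_measurable borel"
    using u v by auto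
  have "integrable (lborel \<Otimes>\<^sub>M lborel) (\<lambda>(x, y). u x * v y)"
    by (rule lborel_pair.Fubini_integrable)
      (use u v in \<open>auto simp: norm_mult intro!: integrable_mult_left integrable_mult_right\<close>)
  then show ?thesis
  proof (rule Bochner_Integration.integrable_bound)
    have "norm (u x * v y) * norm (b (x, y)) \<le> norm (u x * v y)" for x y
      by (intro mult_left_le b) auto
    then show "AE z in lborel \<Otimes>\<^sub>M lborel. norm (case z of (x, y) \<Rightarrow> u x * v y * b (x, y)) \<le> norm (case z of (x, y) \<Rightarrow> u x * v y)"
      by (auto simp only: norm_mult[of "_ * _" "b _"] split: prod.split)
  qed auto
qed

text \<open>The Gaussian makes Fubini's theorem applicable; its transform \<open>P\<close> is a probability density, so
  Schur's test applies to the kernel \<open>P (s - t)\<close>.\<close>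

lemma gaussian_weighted_plancherel:
  fixes g :: "real \<Rightarrow> complex"
  assumes g: "integrable lborel g" and a: "a > 0"
  shows "(\<integral>\<^sup>+x. ennreal (exp (- (a * x)\<^sup>2 / 2) * (norm (fourier g x))\<^sup>2) \<partial>lborel)
      \<le> (\<integral>\<^sup>+t. ennreal ((norm (g t))\<^sup>2) \<partial>lborel)"
proof -
  define \<phi> :: "real \<Rightarrow> complex" where "\<phi> x = of_real (exp (- (a * x)\<^sup>2 / 2))" for x
  define P where "P r = sqrt (2 * pi) / a * exp (- (2 * pi / a * r)\<^sup>2 / 2)" for r
  have [measurable]: "g \<in> borel_measurable borel" using g by auto
  have [measurable]: "\<phi> \<in> borel_measurable borel" unfolding \<phi>_def by measurable
  have [measurable]: "P \<in> borel_measurable borel" unfolding P_def by measurable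
  have P_nonneg: "P r \<ge> 0" for r using a by (simp add: P_def)
  have \<phi>: "integrable lborel \<phi>"
    by (rule integrableI_bounded) (use gaussian_nn_integral[OF a] in \<open>auto simp: \<phi>_def\<close>)
  have inner: "(\<integral>x. \<phi> x * (cis (2 * pi * s * x) * cis (- (2 * pi * t * x))) \<partial>lborel) = of_real (P (s - t))" for s t
  proof -
    have "cis (2 * pi * s * x) * cis (- (2 * pi * t * x)) = cis (2 * pi * (s - t) * x)" for x
      by (simp add: cis_mult algebra_simps)
    then show ?thesis
      using gaussian_fourier[OF a, of "2 * pi * (s - t)"] by (simp add: \<phi>_def P_def)
  qed
  \<comment> \<open>Inverting the Gaussian-damped transform returns \<open>g\<close> smoothed by the
    kernel \<open>P\<close>.\<close>
  have step1: "(\<integral>x. \<phi> x * cis (- (2 * pi * t * x)) * fourier g x \<partial>lborel)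
      = (\<integral>s. g s * of_real (P (s - t)) \<partial>lborel)" for t
  proof -
    have "(\<integral>x. \<phi> x * cis (- (2 * pi * t * x)) * fourier g x \<partial>lborel)
       = (\<integral>x. (\<integral>s. \<phi> x * g s * (cis (2 * pi * s * x) * cis (- (2 * pi * t * x))) \<partial>lborel) \<partial>lborel)"
      unfolding fourier_def by (simp add: integral_mult_right_zero[symmetric] mult_ac del: integral_mult_right_zero)
    also have "\<dots> = (\<integral>s. (\<integral>x. \<phi> x * g s * (cis (2 * pi * s * x) * cis (- (2 * pi * t * x))) \<partial>lborel) \<partial>lborel)"
      using integrable_pair_mult[OF \<phi> g, of "\<lambda>(x, s). cis (2 * pi * s * x) * cis (- (2 * pi * t * x))"]
      by (intro lborel_pair.Fubini_integral[symmetric]) (auto simp: norm_mult split_beta')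
    also have "\<dots> = (\<integral>s. g s * of_real (P (s - t)) \<partial>lborel)"
      unfolding inner[symmetric] by (simp add: integral_mult_right_zero[symmetric] mult_ac del: integral_mult_right_zero)
    finally show ?thesis .
  qed
  have bd: "norm (fourier g x) \<le> (\<integral>t. norm (g t) \<partial>lborel)" for x by (rule fourier_bound[OF g])
  \<comment> \<open>\<open>fourier g\<close> is bounded by the L^1 norm of \<open>g\<close>, so the
    Gaussian alone supplies integrability, here and in \<open>int3\<close>.\<close>
  have int2: "integrable lborel (\<lambda>x. \<phi> x * fourier g x)"
    by (rule Bochner_Integration.integrable_bound[OF integrable_mult_right[OF \<phi>, of "of_real (\<integral>t. norm (g t) \<partial>lborel)"]])
      (auto simp: norm_mult mult.commute intro!: AE_I2 mult_left_mono bd order_trans[OF bd abs_ge_self])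
  have int3: "integrable lborel (\<lambda>x. exp (- (a * x)\<^sup>2 / 2) * (norm (fourier g x))\<^sup>2)"
  proof (rule Bochner_Integration.integrable_bound[OF integrable_mult_right[OF int2, of "of_real (\<integral>t. norm (g t) \<partial>lborel)"]])
    show "AE x in lborel. norm (exp (- (a * x)\<^sup>2 / 2) * (norm (fourier g x))\<^sup>2)
        \<le> norm (of_real (\<integral>t. norm (g t) \<partial>lborel) * (\<phi> x * fourier g x))"
    proof (rule AE_I2)
      fix x
      have "exp (- (a * x)\<^sup>2 / 2) * norm (fourier g x) * norm (fourier g x)
        \<le> exp (- (a * x)\<^sup>2 / 2) * norm (fourier g x) * (\<integral>t. norm (g t) \<partial>lborel)"
        by (intro mult_left_mono bd) auto
      then show "norm (exp (- (a * x)\<^sup>2 / 2) * (norm (fourier g x))\<^sup>2)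
        \<le> norm (of_real (\<integral>t. norm (g t) \<partial>lborel) * (\<phi> x * fourier g x))"
        by (simp add: norm_mult \<phi>_def power2_eq_square mult_ac)
    qed
  qed auto
  \<comment> \<open>Write the squared norm as \<open>fourier g x * cnj (fourier g x)\<close>, expand
    the conjugate factor as an integral over \<open>t\<close>, and exchange: the result is a
    quadratic form in \<open>g\<close> with kernel \<open>P (s - t)\<close>.\<close>
  have "complex_of_real (\<integral>x. exp (- (a * x)\<^sup>2 / 2) * (norm (fourier g x))\<^sup>2 \<partial>lborel)
      = (\<integral>x. \<phi> x * (fourier g x * cnj (fourier g x)) \<partial>lborel)"
    unfolding integral_complex_of_real[symmetric]
    by (simp add: \<phi>_def complex_norm_square[symmetric])
  also have "\<dots> = (\<integral>x. (\<integral>t. (\<phi> x * fourier g x) * cnj (g t) * cis (- (2 * pi * t * x)) \<partial>lborel) \<partial>lborel)"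
  proof -
    have "cnj (fourier g x) = (\<integral>t. cnj (g t) * cis (- (2 * pi * t * x)) \<partial>lborel)" for x
      unfolding fourier_def by (subst Bochner_Integration.integral_cnj[symmetric]) (simp_all add: cis_cnj)
    then show ?thesis by (simp add: mult.assoc)
  qed
  also have "\<dots> = (\<integral>t. (\<integral>x. (\<phi> x * fourier g x) * cnj (g t) * cis (- (2 * pi * t * x)) \<partial>lborel) \<partial>lborel)"
    using integrable_pair_mult[OF int2 integrable_cnj[OF g], of "\<lambda>(x, t). cis (- (2 * pi * t * x))"]
    by (intro lborel_pair.Fubini_integral[symmetric]) (auto simp: split_beta')
  also have "\<dots> = (\<integral>t. cnj (g t) * (\<integral>s. g s * of_real (P (s - t)) \<partial>lborel) \<partial>lborel)"
    unfolding step1[symmetric] integral_mult_right_zero[symmetric] by (simp add: mult_ac)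
  finally have eq: "complex_of_real (\<integral>x. exp (- (a * x)\<^sup>2 / 2) * (norm (fourier g x))\<^sup>2 \<partial>lborel)
      = (\<integral>t. cnj (g t) * (\<integral>s. g s * of_real (P (s - t)) \<partial>lborel) \<partial>lborel)" .
  have P1: "(\<integral>\<^sup>+s. ennreal (P (s - t)) \<partial>lborel) = 1" for t
  proof -
    have "(\<integral>\<^sup>+s. ennreal (P (s - t)) \<partial>lborel) = (\<integral>\<^sup>+s. ennreal (P s) \<partial>lborel)"
      using nn_integral_real_affine[of "\<lambda>s. ennreal (P (s - t))" 1 t] by simp
    also have "\<dots> = ennreal (sqrt (2 * pi) / a) * (\<integral>\<^sup>+s. ennreal (exp (- (2 * pi / a * s)\<^sup>2 / 2)) \<partial>lborel)"
      unfolding P_def using a by (subst nn_integral_cmult[symmetric]) (auto simp: ennreal_mult'[symmetric])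
    also have "\<dots> = 1"
      using a by (subst gaussian_nn_integral) (auto simp: ennreal_mult'[symmetric])
    finally show ?thesis .
  qed
  \<comment> \<open>\<open>P\<close> is even, so its mass is 1 in either variable.\<close>
  have P2: "(\<integral>\<^sup>+t. ennreal (P (s - t)) \<partial>lborel) = 1" for s
    using P1[of s] by (simp add: P_def power2_eq_square algebra_simps)
  have "(\<integral>\<^sup>+x. ennreal (exp (- (a * x)\<^sup>2 / 2) * (norm (fourier g x))\<^sup>2) \<partial>lborel)
      = ennreal (\<integral>x. exp (- (a * x)\<^sup>2 / 2) * (norm (fourier g x))\<^sup>2 \<partial>lborel)"
    by (rule nn_integral_eq_integral[OF int3]) auto
  also have "\<dots> = ennreal (norm (\<integral>t. cnj (g t) * (\<integral>s. g s * of_real (P (s - t)) \<partial>lborel) \<partial>lborel))"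
    unfolding eq[symmetric] by simp
  also have "\<dots> \<le> (\<integral>\<^sup>+t. ennreal (norm (cnj (g t) * (\<integral>s. g s * of_real (P (s - t)) \<partial>lborel))) \<partial>lborel)"
    by (rule ennreal_norm_integral_le)
  also have "\<dots> \<le> (\<integral>\<^sup>+t. ennreal (norm (g t)) * (\<integral>\<^sup>+s. ennreal (norm (g s)) * ennreal (P (s - t)) \<partial>lborel) \<partial>lborel)"
  proof (rule nn_integral_mono)
    fix t
    have "ennreal (norm (\<integral>s. g s * of_real (P (s - t)) \<partial>lborel))
        \<le> (\<integral>\<^sup>+s. ennreal (norm (g s * of_real (P (s - t)))) \<partial>lborel)"
      by (rule ennreal_norm_integral_le)
    then show "ennreal (norm (cnj (g t) * (\<integral>s. g s * of_real (P (s - t)) \<partial>lborel)))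
        \<le> ennreal (norm (g t)) * (\<integral>\<^sup>+s. ennreal (norm (g s)) * ennreal (P (s - t)) \<partial>lborel)"
      using P_nonneg by (auto simp: norm_mult ennreal_mult intro!: mult_left_mono)
  qed
  also have "\<dots> = (\<integral>\<^sup>+t. (\<integral>\<^sup>+s. ennreal (norm (g t)) * (ennreal (norm (g s)) * ennreal (P (s - t))) \<partial>lborel) \<partial>lborel)"
    by (simp add: nn_integral_cmult)
  \<comment> \<open>The Schur test in its simplest form: by the arithmetic-geometric mean inequality
    each summand depends on \<open>g\<close> at one point only, and \<open>P\<close> can then be
    integrated out in the other variable.\<close>
  also have "\<dots> \<le> (\<integral>\<^sup>+t. (\<integral>\<^sup>+s. ennreal ((norm (g t))\<^sup>2 / 2) * ennreal (P (s - t)) + ennreal ((norm (g s))\<^sup>2 / 2) * ennreal (P (s - t)) \<partial>lborel) \<partial>lborel)"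
  proof (intro nn_integral_mono)
    fix s t
    have "norm (g t) * norm (g s) \<le> (norm (g t))\<^sup>2 / 2 + (norm (g s))\<^sup>2 / 2"
      using sum_squares_bound[of "norm (g t)" "norm (g s)"] by simp
    then show "ennreal (norm (g t)) * (ennreal (norm (g s)) * ennreal (P (s - t)))
       \<le> ennreal ((norm (g t))\<^sup>2 / 2) * ennreal (P (s - t)) + ennreal ((norm (g s))\<^sup>2 / 2) * ennreal (P (s - t))"
      using P_nonneg[of "s - t"]
      by (subst distrib_right[symmetric], subst mult.assoc[symmetric], intro mult_right_mono)
        (auto simp: ennreal_mult'[symmetric] ennreal_plus[symmetric] simp del: ennreal_plus)
  qed
  also have "\<dots> = (\<integral>\<^sup>+t. (\<integral>\<^sup>+s. ennreal ((norm (g t))\<^sup>2 / 2) * ennreal (P (s - t)) \<partial>lborel) \<partial>lborel)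
      + (\<integral>\<^sup>+t. (\<integral>\<^sup>+s. ennreal ((norm (g s))\<^sup>2 / 2) * ennreal (P (s - t)) \<partial>lborel) \<partial>lborel)"
    by (simp add: nn_integral_add)
  also have "(\<integral>\<^sup>+t. (\<integral>\<^sup>+s. ennreal ((norm (g s))\<^sup>2 / 2) * ennreal (P (s - t)) \<partial>lborel) \<partial>lborel)
      = (\<integral>\<^sup>+s. (\<integral>\<^sup>+t. ennreal ((norm (g s))\<^sup>2 / 2) * ennreal (P (s - t)) \<partial>lborel) \<partial>lborel)"
    by (rule lborel_pair.Fubini') measurable
  also have "(\<integral>\<^sup>+t. (\<integral>\<^sup>+s. ennreal ((norm (g t))\<^sup>2 / 2) * ennreal (P (s - t)) \<partial>lborel) \<partial>lborel)
      + (\<integral>\<^sup>+s. (\<integral>\<^sup>+t. ennreal ((norm (g s))\<^sup>2 / 2) * ennreal (P (s - t)) \<partial>lborel) \<partial>lborel)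
     = (\<integral>\<^sup>+t. ennreal ((norm (g t))\<^sup>2 / 2) + ennreal ((norm (g t))\<^sup>2 / 2) \<partial>lborel)"
    by (simp add: nn_integral_cmult P1 P2 nn_integral_add)
  also have "\<dots> = (\<integral>\<^sup>+t. ennreal ((norm (g t))\<^sup>2) \<partial>lborel)"
    by (simp add: ennreal_plus[symmetric] del: ennreal_plus)
  finally show ?thesis .
qed

text \<open>The Gaussian weights with \<open>a = 1 / (n + 1)\<close> tend to 1 pointwise, and
  Fatou's lemma passes the uniform bound to the limit. The right-hand side may be infinite.\<close>

lemma plancherel_le:
  fixes g :: "real \<Rightarrow> complex"
  assumes g: "integrable lborel g"
  shows "(\<integral>\<^sup>+x. ennreal ((norm (fourier g x))\<^sup>2) \<partial>lborel) \<le> (\<integral>\<^sup>+t. ennreal ((norm (g t))\<^sup>2) \<partial>lborel)"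
proof -
  have [measurable]: "g \<in> borel_measurable borel" using g by auto
  define u where "u n x = ennreal (exp (- (1 / real (Suc n) * x)\<^sup>2 / 2) * (norm (fourier g x))\<^sup>2)" for n x
  have "(\<lambda>n. u n x) \<longlonglongrightarrow> ennreal (exp (- (0 * x)\<^sup>2 / 2) * (norm (fourier g x))\<^sup>2)" for x
    unfolding u_def by (intro tendsto_intros lim_1_over_n LIMSEQ_Suc[OF lim_1_over_n]) auto
  then have "liminf (\<lambda>n. u n x) = ennreal ((norm (fourier g x))\<^sup>2)" for x
    by (simp add: lim_imp_Liminf)
  then have "(\<integral>\<^sup>+x. ennreal ((norm (fourier g x))\<^sup>2) \<partial>lborel) = (\<integral>\<^sup>+x. liminf (\<lambda>n. u n x) \<partial>lborel)"
    by simp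
  also have "\<dots> \<le> liminf (\<lambda>n. \<integral>\<^sup>+x. u n x \<partial>lborel)"
    by (rule nn_integral_liminf) (simp add: u_def)
  also have "\<dots> \<le> (\<integral>\<^sup>+t. ennreal ((norm (g t))\<^sup>2) \<partial>lborel)"
    unfolding u_def
    by (intro Liminf_le always_eventually allI gaussian_weighted_plancherel[OF g]) auto
  finally show ?thesis .
qed

section \<open>Hardy's inequality\<close>

lemma nn_integral_powr_from_0:
  fixes a c :: real
  assumes "a > -1" "c \<ge> 0"
  shows "(\<integral>\<^sup>+x. ennreal (x powr a) * indicator {0<..<c} x \<partial>lborel) = ennreal (c powr (a + 1) / (a + 1))"
proof -
  have "(\<integral>\<^sup>+x. ennreal (x powr a) * indicator {0<..<c} x \<partial>lborel)
      = (\<integral>\<^sup>+x. ennreal (indicator {0..c} x * x powr a) \<partial>lborel)"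
    \<comment> \<open>The two intervals differ only in their endpoints: \<open>0 powr a\<close> is 0
      by convention, and \<open>c\<close> is a null point.\<close>
    by (rule nn_integral_cong_AE, use AE_lborel_singleton[of c] in eventually_elim)
      (auto simp: indicator_def)
  also have "\<dots> = ennreal (c powr (a + 1) / (a + 1))"
    by (rule nn_integral_has_integral_lebesgue[OF _ has_integral_powr_from_0[OF assms]]) auto
  finally show ?thesis .
qed

lemma nn_integral_powr_to_inf:
  fixes e a :: real
  assumes "e < -1" "a > 0"
  shows "(\<integral>\<^sup>+x. ennreal (x powr e) * indicator {a<..} x \<partial>lborel) = ennreal (- (a powr (e + 1)) / (e + 1))"
proof -
  have "(\<integral>\<^sup>+x. ennreal (x powr e) * indicator {a<..} x \<partial>lborel)
      = (\<integral>\<^sup>+x. ennreal (indicator {a..} x * x powr e) \<partial>lborel)"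
    by (rule nn_integral_cong_AE, use AE_lborel_singleton[of a] in eventually_elim)
      (auto simp: indicator_def)
  also have "\<dots> = ennreal (- (a powr (e + 1)) / (e + 1))"
    by (rule nn_integral_has_integral_lebesgue[OF _ has_integral_powr_to_inf[OF assms]]) auto
  finally show ?thesis .
qed

text \<open>Either \<open>x\<close> is at most \<open>A\<close>, or
  \<open>(x / A) powr (p - 1)\<close> is at least 1 and may be inserted as a factor.\<close>

lemma le_powr_mult_add:
  fixes x A p :: real
  assumes "x \<ge> 0" "A > 0" "p \<ge> 1"
  shows "x \<le> x powr p * A powr (1 - p) + A"
proof (cases "x \<le> A")
  case False
  then have "x * 1 \<le> x * (x / A) powr (p - 1)"
    using assms by (intro mult_left_mono ge_one_powr_ge_zero) auto
  also have "\<dots> = x powr p * A powr (1 - p)"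
    using assms False by (simp add: powr_divide powr_diff field_simps)
  finally show ?thesis using assms by simp
qed (use assms in \<open>simp add: add_increasing\<close>)

text \<open>The exponent exceeds that of the target weight \<open>s powr (p - 2)\<close> by 1/2.
  This surplus is returned when \<open>t powr (- 3 / 2)\<close> is integrated over
  \<open>t > s\<close> in Hardy's inequality.\<close>

definition hardy_moment :: "real \<Rightarrow> (real \<Rightarrow> real) \<Rightarrow> real \<Rightarrow> ennreal" where
  "hardy_moment p u t = (\<integral>\<^sup>+s. ennreal (u s powr p * s powr (p - 3 / 2)) * indicator {0<..<t} s \<partial>lborel)"

text \<open>A substitute for Hoelder's inequality: \<open>le_powr_mult_add\<close> applied with \<open>A = M s\<^bsup>-\<beta>\<^esup>\<close>, leaving \<open>M\<close> free to be optimised.\<close>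

lemma nn_integral_le_hardy_moment:
  fixes u :: "real \<Rightarrow> real"
  assumes [measurable]: "u \<in> borel_measurable borel" and u: "\<And>s. u s \<ge> 0"
    and p: "p > 1" and M: "M > 0" and t: "t > 0"
  shows "(\<integral>\<^sup>+s. ennreal (u s) * indicator {0<..<t} s \<partial>lborel)
    \<le> ennreal (M powr (1 - p)) * hardy_moment p u t + ennreal (M * (2 * (p - 1) * t powr (1 / (2 * (p - 1)))))"
proof -
  \<comment> \<open>Chosen so that \<open>s powr (- \<beta>)\<close>, raised to the power
    \<open>1 - p\<close>, is the weight of \<open>hardy_moment\<close>. Since
    \<open>\<beta> < 1\<close>, it is also integrable at 0.\<close>
  define \<beta> where "\<beta> = (p - 3 / 2) / (p - 1)"
  have \<beta>: "1 - \<beta> = 1 / (2 * (p - 1))" "\<beta> * (p - 1) = p - 3 / 2" using p by (auto simp: \<beta>_def field_simps)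
  have \<beta>': "- \<beta> + 1 = 1 / (2 * (p - 1))" using \<beta>(1) by simp
  have \<beta>1: "- \<beta> > -1" using \<beta>' p by (smt (verit) divide_pos_pos)
  have pt: "ennreal (u s) \<le> ennreal (M powr (1 - p)) * ennreal (u s powr p * s powr (p - 3 / 2)) + ennreal M * ennreal (s powr (- \<beta>))"
    if "s > 0" for s
  proof -
    have "u s \<le> u s powr p * (M * s powr (- \<beta>)) powr (1 - p) + M * s powr (- \<beta>)"
      using that M p u by (intro le_powr_mult_add) auto
    also have "(M * s powr (- \<beta>)) powr (1 - p) = M powr (1 - p) * s powr (p - 3 / 2)"
      using M that by (simp add: powr_mult powr_powr \<beta>(2)[symmetric] algebra_simps)
    finally show ?thesis using M
      by (simp add: ennreal_mult'[symmetric] ennreal_plus[symmetric] mult_ac del: ennreal_plus)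
  qed
  have "(\<integral>\<^sup>+s. ennreal (u s) * indicator {0<..<t} s \<partial>lborel)
     \<le> (\<integral>\<^sup>+s. ennreal (M powr (1 - p)) * (ennreal (u s powr p * s powr (p - 3 / 2)) * indicator {0<..<t} s)
          + ennreal M * (ennreal (s powr (- \<beta>)) * indicator {0<..<t} s) \<partial>lborel)"
    by (intro nn_integral_mono) (use pt in \<open>auto split: split_indicator\<close>)
  also have "\<dots> = ennreal (M powr (1 - p)) * hardy_moment p u t + ennreal M * ennreal (t powr (- \<beta> + 1) / (- \<beta> + 1))"
    using t by (simp add: nn_integral_add nn_integral_cmult hardy_moment_def nn_integral_powr_from_0[OF \<beta>1])
  also have "ennreal M * ennreal (t powr (- \<beta> + 1) / (- \<beta> + 1)) = ennreal (M * (2 * (p - 1) * t powr (1 / (2 * (p - 1)))))"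
    unfolding \<beta>' using M p by (simp add: ennreal_mult'[symmetric] field_simps)
  finally show ?thesis .
qed

text \<open>Optimise the free parameter \<open>M\<close> in
  \<open>nn_integral_le_hardy_moment\<close>. At the balancing value the two terms are 1 and
  \<open>2 * (p - 1)\<close> times the same quantity, which explains the factor
  \<open>2 * p - 1\<close>.\<close>

lemma powr_le_hardy_moment:
  fixes u :: "real \<Rightarrow> real"
  assumes [measurable]: "u \<in> borel_measurable borel" and u: "\<And>s. u s \<ge> 0"
    and p: "p > 1" and t: "t > 0" and G: "G \<ge> 0"
    and G': "ennreal G \<le> (\<integral>\<^sup>+s. ennreal (u s) * indicator {0<..<t} s \<partial>lborel)"
  shows "ennreal (G powr p) \<le> ennreal ((2 * p - 1) powr p * t powr (1 / 2)) * hardy_moment p u t"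
proof (cases "hardy_moment p u t")
  case top
  then show ?thesis using p t by (simp add: ennreal_mult_top)
next
  case (real H)
  define \<gamma> where "\<gamma> = 1 / (2 * (p - 1))"
  have G_le: "G \<le> M powr (1 - p) * H + M * (2 * (p - 1) * t powr \<gamma>)" if "M > 0" for M
  proof -
    have "ennreal G \<le> ennreal (M powr (1 - p)) * ennreal H + ennreal (M * (2 * (p - 1) * t powr \<gamma>))"
      using order_trans[OF G' nn_integral_le_hardy_moment[OF assms(1) u p that t]] real by (simp add: \<gamma>_def)
    also have "\<dots> = ennreal (M powr (1 - p) * H + M * (2 * (p - 1) * t powr \<gamma>))"
      using that p real by (subst ennreal_plus) (auto simp: ennreal_mult')
    finally show ?thesis
      using that p real by (subst (asm) ennreal_le_iff) auto
  qed
  have "G powr p \<le> (2 * p - 1) powr p * t powr (1 / 2) * H"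
  proof (cases "H = 0")
    case True
    define c where "c = 2 * (p - 1) * t powr \<gamma>"
    have c: "c > 0" using p t by (simp add: c_def)
    \<comment> \<open>With \<open>H = 0\<close> there is no balancing value, but \<open>M\<close>
      may be arbitrarily small; the choice below gives \<open>G \<le> G / 2\<close>.\<close>
    have "G \<le> 0"
    proof (rule ccontr)
      assume "\<not> G \<le> 0"
      then have "G \<le> G / (2 * c) * c" using G_le[of "G / (2 * c)"] c True by (simp add: c_def)
      then show False using c \<open>\<not> G \<le> 0\<close> by simp
    qed
    then show ?thesis using G True by simp
  next
    case False
    then have H: "H > 0" using real by simp
    \<comment> \<open>The solution of
      \<open>M powr (1 - p) * H = M * t powr \<gamma>\<close>.\<close>
    define M where "M = (H * t powr (- \<gamma>)) powr (1 / p)"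
    have M: "M > 0" using H t by (simp add: M_def)
    have Mp: "M powr p = H * t powr (- \<gamma>)" using H t p by (simp add: M_def powr_powr)
    have "M powr (1 - p) * H = M * t powr \<gamma>"
      using M t H by (simp add: powr_diff Mp powr_minus field_simps)
    then have "G \<le> (2 * p - 1) * (M * t powr \<gamma>)"
      using G_le[OF M] by (simp add: algebra_simps)
    then have "G powr p \<le> ((2 * p - 1) * (M * t powr \<gamma>)) powr p"
      using G p by (intro powr_mono2) auto
    also have "\<dots> = (2 * p - 1) powr p * (H * (t powr (- \<gamma>) * t powr (\<gamma> * p)))"
      using p M t by (simp add: powr_mult Mp powr_powr)
    also have "t powr (- \<gamma>) * t powr (\<gamma> * p) = t powr (\<gamma> * (p - 1))"
      unfolding powr_add[symmetric] by (simp add: algebra_simps)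
    also have "\<gamma> * (p - 1) = 1 / 2"
      using p by (simp add: \<gamma>_def)
    finally show ?thesis by (simp add: mult_ac)
  qed
  then show ?thesis
    using real by (simp add: ennreal_mult'[symmetric])
qed

text \<open>On \<open>(0, t)\<close> the surplus factor \<open>s powr (1 / 2)\<close> is at most
  \<open>t powr (1 / 2)\<close>. Finiteness of the weighted integral therefore gives finiteness of
  the moment.\<close>

lemma hardy_moment_le:
  assumes "t > 0" and [measurable]: "u \<in> borel_measurable borel"
  shows "hardy_moment p u t \<le> ennreal (t powr (1 / 2)) * (\<integral>\<^sup>+s. ennreal (u s powr p * s powr (p - 2)) * indicator {0<..} s \<partial>lborel)"
proof -
  have "u s powr p * s powr (p - 3 / 2) \<le> t powr (1 / 2) * (u s powr p * s powr (p - 2))" if "0 < s" "s < t" for s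
  proof -
    have "s powr (p - 3 / 2) = s powr (1 / 2) * s powr (p - 2)" by (simp add: powr_add[symmetric])
    moreover have "s powr (1 / 2) \<le> t powr (1 / 2)" using that by (intro powr_mono2) auto
    ultimately show ?thesis
      using mult_right_mono[of "s powr (1 / 2)" "t powr (1 / 2)" "u s powr p * s powr (p - 2)"] by (simp add: mult_ac)
  qed
  then show ?thesis
    unfolding hardy_moment_def
    by (subst nn_integral_cmult[symmetric]) (auto intro!: nn_integral_mono simp: ennreal_mult'[symmetric] split: split_indicator)
qed

text \<open>Insert the pointwise bound by \<open>hardy_moment\<close> and exchange the integrals
  over the region \<open>0 < s < t\<close>. The integral of \<open>t powr (- 3 / 2)\<close> over
  \<open>t > s\<close> is \<open>2 * s powr (- 1 / 2)\<close>, which restores the weight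
  \<open>s powr (p - 2)\<close> and contributes the factor 2.\<close>

lemma hardy_inequality:
  fixes u G :: "real \<Rightarrow> real"
  assumes [measurable]: "u \<in> borel_measurable borel" and u: "\<And>s. u s \<ge> 0"
    and p: "p > 1" and G: "\<And>t. G t \<ge> 0"
    and G': "\<And>t. t > 0 \<Longrightarrow> ennreal (G t) \<le> (\<integral>\<^sup>+s. ennreal (u s) * indicator {0<..<t} s \<partial>lborel)"
  shows "(\<integral>\<^sup>+t. ennreal (G t powr p * t powr (- 2)) * indicator {0<..} t \<partial>lborel)
    \<le> ennreal (2 * (2 * p - 1) powr p) * (\<integral>\<^sup>+s. ennreal (u s powr p * s powr (p - 2)) * indicator {0<..} s \<partial>lborel)"
proof -
  define K where "K = (2 * p - 1) powr p"
  have K: "K \<ge> 0" by (simp add: K_def)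
  have "(\<integral>\<^sup>+t. ennreal (G t powr p * t powr (- 2)) * indicator {0<..} t \<partial>lborel)
     \<le> (\<integral>\<^sup>+t. (\<integral>\<^sup>+s. ennreal K * (ennreal (u s powr p * s powr (p - 3 / 2)) * indicator {0<..} s *
           (ennreal (t powr (- 3 / 2)) * indicator {s<..} t)) \<partial>lborel) \<partial>lborel)"
  proof (rule nn_integral_mono)
    fix t :: real
    show "ennreal (G t powr p * t powr (- 2)) * indicator {0<..} t
      \<le> (\<integral>\<^sup>+s. ennreal K * (ennreal (u s powr p * s powr (p - 3 / 2)) * indicator {0<..} s *
           (ennreal (t powr (- 3 / 2)) * indicator {s<..} t)) \<partial>lborel)"
    proof (cases "t > 0")
      case True
      have "ennreal (G t powr p * t powr (- 2)) = ennreal (t powr (- 2)) * ennreal (G t powr p)"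
        by (simp add: ennreal_mult'[symmetric] mult.commute)
      also have "\<dots> \<le> ennreal (t powr (- 2)) * (ennreal (K * t powr (1 / 2)) * hardy_moment p u t)"
        unfolding K_def by (intro mult_left_mono powr_le_hardy_moment assms G True G') auto
      also have "\<dots> = ennreal K * ennreal (t powr (- 3 / 2)) * hardy_moment p u t"
        unfolding mult.assoc[symmetric] using K
        by (simp add: ennreal_mult'[symmetric] mult_ac powr_add[symmetric])
      also have "\<dots> = (\<integral>\<^sup>+s. ennreal K * ennreal (t powr (- 3 / 2)) * (ennreal (u s powr p * s powr (p - 3 / 2)) * indicator {0<..<t} s) \<partial>lborel)"
        unfolding hardy_moment_def by (subst nn_integral_cmult) auto
      also have "\<dots> = (\<integral>\<^sup>+s. ennreal K * (ennreal (u s powr p * s powr (p - 3 / 2)) * indicator {0<..} s *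
           (ennreal (t powr (- 3 / 2)) * indicator {s<..} t)) \<partial>lborel)"
        by (intro nn_integral_cong) (auto simp: mult_ac split: split_indicator)
      finally show ?thesis using True by simp
    qed simp
  qed
  also have "\<dots> = (\<integral>\<^sup>+s. (\<integral>\<^sup>+t. ennreal K * (ennreal (u s powr p * s powr (p - 3 / 2)) * indicator {0<..} s *
           (ennreal (t powr (- 3 / 2)) * indicator {s<..} t)) \<partial>lborel) \<partial>lborel)"
  proof (rule lborel_pair.Fubini')
    \<comment> \<open>The half-line \<open>{s<..}\<close> moves with \<open>s\<close>, so joint
      measurability of its indicator needs this predicate on pairs.\<close>
    have [measurable]: "Measurable.pred (lborel \<Otimes>\<^sub>M lborel) (\<lambda>x::real \<times> real. snd x \<in> {fst x<..})"
      by simp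
    show "(\<lambda>(s, t). ennreal K * (ennreal (u s powr p * s powr (p - 3 / 2)) * indicator {0<..} s *
           (ennreal (t powr (- 3 / 2)) * indicator {s<..} t))) \<in> borel_measurable (lborel \<Otimes>\<^sub>M lborel)"
      unfolding split_beta' by measurable
  qed
  also have "\<dots> = (\<integral>\<^sup>+s. ennreal (2 * K) * (ennreal (u s powr p * s powr (p - 2)) * indicator {0<..} s) \<partial>lborel)"
  proof (rule nn_integral_cong)
    fix s :: real
    show "(\<integral>\<^sup>+t. ennreal K * (ennreal (u s powr p * s powr (p - 3 / 2)) * indicator {0<..} s *
           (ennreal (t powr (- 3 / 2)) * indicator {s<..} t)) \<partial>lborel)
       = ennreal (2 * K) * (ennreal (u s powr p * s powr (p - 2)) * indicator {0<..} s)"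
    proof (cases "s > 0")
      case True
      have "(\<integral>\<^sup>+t. ennreal K * (ennreal (u s powr p * s powr (p - 3 / 2)) * indicator {0<..} s *
           (ennreal (t powr (- 3 / 2)) * indicator {s<..} t)) \<partial>lborel)
        = ennreal K * (ennreal (u s powr p * s powr (p - 3 / 2)) * ennreal (2 * s powr (- 1 / 2)))"
        using True nn_integral_powr_to_inf[of "- 3 / 2" s] by (simp add: nn_integral_cmult mult.commute[of _ "2::real"])
      also have "\<dots> = ennreal (K * (u s powr p * (s powr (p - 3 / 2) * (2 * s powr (- 1 / 2)))))"
        using K by (simp add: ennreal_mult'[symmetric] mult_ac)
      also have "s powr (p - 3 / 2) * (2 * s powr (- 1 / 2)) = 2 * s powr (p - 2)"
        by (simp add: powr_add[symmetric])
      finally show ?thesis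
        using True K by (simp add: ennreal_mult'[symmetric] mult_ac)
    qed simp
  qed
  also have "\<dots> = ennreal (2 * K) * (\<integral>\<^sup>+s. ennreal (u s powr p * s powr (p - 2)) * indicator {0<..} s \<partial>lborel)"
    by (rule nn_integral_cmult) measurable
  finally show ?thesis by (simp add: K_def)
qed

section \<open>Fourier transforms in weighted spaces\<close>

lemma layer_cake_powr:
  fixes X q :: real
  assumes "q > 0" "X \<ge> 0"
  shows "(\<integral>\<^sup>+l. ennreal (q * l powr (q - 1)) * indicator {0<..<X} l \<partial>lborel) = ennreal (X powr q)"
proof -
  have "(\<integral>\<^sup>+l. ennreal (q * l powr (q - 1)) * indicator {0<..<X} l \<partial>lborel)
     = ennreal q * (\<integral>\<^sup>+l. ennreal (l powr (q - 1)) * indicator {0<..<X} l \<partial>lborel)"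
    using assms by (subst nn_integral_cmult[symmetric]) (auto simp: ennreal_mult' mult_ac)
  also have "\<dots> = ennreal (X powr q)"
    using assms by (subst nn_integral_powr_from_0) (auto simp: ennreal_mult'[symmetric])
  finally show ?thesis .
qed

text \<open>The sublevel set is an initial segment because \<open>G\<close> is monotone. If it is
  unbounded, \<open>G \<le> c\<close> everywhere and the total mass is the limit of \<open>G\<close>
  at infinity. Otherwise its mass is at most that below its supremum, which is a left limit of
  values of \<open>G\<close>.\<close>

lemma integral_sublevel_le:
  fixes u :: "real \<Rightarrow> real"
  assumes u: "integrable lborel u" "\<And>s. u s \<ge> 0" and c: "c \<ge> 0"
  defines "G \<equiv> \<lambda>t. \<integral>s. indicator {..t} s *\<^sub>R u s \<partial>lborel"
  shows "(\<integral>s. indicator {t. G t \<le> c} s *\<^sub>R u s \<partial>lborel) \<le> c"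
proof -
  have [measurable]: "u \<in> borel_measurable borel" using u by auto
  have int: "integrable lborel (\<lambda>s. indicator A s *\<^sub>R u s)" if "A \<in> sets borel" for A
    using that u by (intro integrable_mult_indicator) auto
  have "mono G"
    unfolding G_def by (intro monoI integral_mono int) (auto simp: u split: split_indicator)
  then have [measurable]: "G \<in> borel_measurable borel" by (rule borel_measurable_mono)
  define S where "S = {t. G t \<le> c}"
  have [measurable]: "S \<in> sets borel" unfolding S_def by measurable
  show ?thesis unfolding S_def[symmetric]
  proof (cases "bdd_above S")
    case False
    have "G y \<le> c" for y
    proof -
      obtain s where "s \<in> S" "y < s" using False by (auto simp: bdd_above_def not_le)
      then show ?thesis using monoD[OF \<open>mono G\<close>, of y s] by (auto simp: S_def)
    qed
    moreover have "(G \<longlongrightarrow> (\<integral>s. u s \<partial>lborel)) at_top"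
      unfolding G_def by (rule tendsto_integral_at_top) (use u in auto)
    ultimately have "(\<integral>s. u s \<partial>lborel) \<le> c"
      by (intro tendsto_upperbound) auto
    moreover have "(\<integral>s. indicator S s *\<^sub>R u s \<partial>lborel) \<le> (\<integral>s. u s \<partial>lborel)"
      by (intro integral_mono int u) (auto simp: u split: split_indicator)
    ultimately show "(\<integral>s. indicator S s *\<^sub>R u s \<partial>lborel) \<le> c" by simp
  next
    case True
    show "(\<integral>s. indicator S s *\<^sub>R u s \<partial>lborel) \<le> c"
    proof (cases "S = {}")
      case False
      define a where "a = Sup S"
      have "G y \<le> c" if "y < a" for y
      proof -
        obtain s where "s \<in> S" "y < s"
          using \<open>y < a\<close> False True by (auto simp: a_def less_cSup_iff)
        then show ?thesis using monoD[OF \<open>mono G\<close>, of y s] by (auto simp: S_def)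
      qed
      moreover have "(\<lambda>n. G (a - 1 / real (Suc n))) \<longlonglongrightarrow> (\<integral>s. indicator {..<a} s *\<^sub>R u s \<partial>lborel)"
        unfolding G_def
      proof (rule integral_dominated_convergence[where w=u])
        show "AE s in lborel. (\<lambda>n. indicator {..a - 1 / real (Suc n)} s *\<^sub>R u s) \<longlonglongrightarrow> indicator {..<a} s *\<^sub>R u s"
        proof (intro AE_I2 tendsto_scaleR tendsto_const tendsto_eventually)
          fix s
          show "\<forall>\<^sub>F n in sequentially. indicator {..a - 1 / real (Suc n)} s = (indicator {..<a} s :: real)"
          proof (cases "s < a")
            case True
            have "(\<lambda>n. a - 1 / real (Suc n)) \<longlonglongrightarrow> a - 0"
              by (intro tendsto_intros LIMSEQ_Suc[OF lim_1_over_n])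
            then have "\<forall>\<^sub>F n in sequentially. s < a - 1 / real (Suc n)"
              using True by (auto dest: order_tendstoD)
            then show ?thesis by eventually_elim (use True in auto)
          next
            case False
            have "\<not> s \<le> a - 1 / real (Suc n)" for n
              using False zero_less_divide_1_iff[of "real (Suc n)"] by linarith
            then show ?thesis using False by (auto intro: always_eventually)
          qed
        qed
      qed (use u in \<open>auto split: split_indicator\<close>)
      ultimately have "(\<integral>s. indicator {..<a} s *\<^sub>R u s \<partial>lborel) \<le> c"
        by (intro LIMSEQ_le_const2) auto
      moreover have "(\<integral>s. indicator S s *\<^sub>R u s \<partial>lborel) \<le> (\<integral>s. indicator {..a} s *\<^sub>R u s \<partial>lborel)"
        using True by (intro integral_mono int) (auto simp: a_def u intro: cSup_upper split: split_indicator)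
      \<comment> \<open>The left limit misses the point \<open>a\<close> itself, which is
        null.\<close>
      moreover have "(\<integral>s. indicator {..a} s *\<^sub>R u s \<partial>lborel) = (\<integral>s. indicator {..<a} s *\<^sub>R u s \<partial>lborel)"
        by (intro integral_cong_AE, measurable, use AE_lborel_singleton[of a] in eventually_elim)
          (auto split: split_indicator)
      ultimately show ?thesis by simp
    qed (use c in simp)
  qed
qed

text \<open>For \<open>l > 0\<close> the indicator \<open>indicator {0<..<X} l\<close> says
  \<open>l < X\<close>; in this form both sides can later be integrated over \<open>l\<close>. The
  factor \<open>4 / l\<^sup>2\<close> is Chebyshev's constant at height
  \<open>l / 2\<close>.\<close>

lemma fourier_distribution_le:
  fixes h :: "real \<Rightarrow> complex"
  assumes h: "integrable lborel h" and l: "l > 0"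
  defines "G \<equiv> \<lambda>t. \<integral>s. indicator {..t} s *\<^sub>R norm (h s) \<partial>lborel"
  shows "(\<integral>\<^sup>+x. indicator {0<..<norm (fourier h x)} l \<partial>lborel)
     \<le> ennreal (4 / l\<^sup>2) * (\<integral>\<^sup>+t. ennreal ((norm (h t))\<^sup>2) * indicator {0<..<2 * G t} l \<partial>lborel)"
proof -
  have [measurable]: "h \<in> borel_measurable borel" using h by auto
  have int: "integrable lborel (\<lambda>s. indicator A s *\<^sub>R norm (h s))" if "A \<in> sets borel" for A
    using that h by (intro integrable_mult_indicator) auto
  have int': "integrable lborel (\<lambda>s. indicator A s *\<^sub>R h s)" if "A \<in> sets borel" for A
    using that h by (intro integrable_mult_indicator) auto
  have "mono G"
    unfolding G_def by (intro monoI integral_mono int) (auto split: split_indicator)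
  then have [measurable]: "G \<in> borel_measurable borel" by (rule borel_measurable_mono)
  \<comment> \<open>The piece on \<open>S\<close> has L^1 norm at most \<open>l / 2\<close>, so
    wherever the transform exceeds \<open>l\<close> the other piece must contribute at least
    \<open>l / 2\<close>.\<close>
  define S where "S = {t. G t \<le> l / 2}"
  have S[measurable]: "S \<in> sets borel" unfolding S_def by measurable
  then have S': "- S \<in> sets borel" by auto
  define h1 where "h1 s = indicator S s *\<^sub>R h s" for s
  define h2 where "h2 s = indicator (- S) s *\<^sub>R h s" for s
  have [measurable]: "h2 \<in> borel_measurable borel" unfolding h2_def by measurable
  have "fourier h x = fourier h1 x + fourier h2 x" for x
  proof -
    have "h = (\<lambda>s. h1 s + h2 s)" by (auto simp: h1_def h2_def split: split_indicator)
    moreover have "integrable lborel h1" "integrable lborel h2"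
      unfolding h1_def h2_def by (intro int' S S')+
    ultimately show ?thesis using fourier_add[of h1 h2 x] by simp
  qed
  moreover have "norm (fourier h1 x) \<le> l / 2" for x
  proof -
    have "norm (fourier h1 x) \<le> (\<integral>s. norm (h1 s) \<partial>lborel)"
      unfolding h1_def by (rule fourier_bound[OF int'[OF S]])
    also have "\<dots> = (\<integral>s. indicator S s *\<^sub>R norm (h s) \<partial>lborel)"
      by (simp add: h1_def)
    also have "\<dots> \<le> l / 2"
      unfolding S_def G_def by (rule integral_sublevel_le) (use h l in auto)
    finally show ?thesis .
  qed
  ultimately have norm_le: "norm (fourier h x) \<le> l / 2 + norm (fourier h2 x)" for x
    by (metis add_mono norm_triangle_ineq order_refl order_trans)
  have "(\<integral>\<^sup>+x. indicator {0<..<norm (fourier h x)} l \<partial>lborel)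
      \<le> (\<integral>\<^sup>+x. ennreal (4 / l\<^sup>2) * ennreal ((norm (fourier h2 x))\<^sup>2) \<partial>lborel)"
  proof (rule nn_integral_mono)
    fix x
    show "indicator {0<..<norm (fourier h x)} l \<le> ennreal (4 / l\<^sup>2) * ennreal ((norm (fourier h2 x))\<^sup>2)"
    proof (cases "l < norm (fourier h x)")
      case True
      then have "l / 2 \<le> norm (fourier h2 x)" using norm_le[of x] by simp
      then have "(l / 2)\<^sup>2 \<le> (norm (fourier h2 x))\<^sup>2" using l by (intro power_mono) auto
      then have "1 \<le> 4 / l\<^sup>2 * (norm (fourier h2 x))\<^sup>2" using l by (simp add: field_simps)
      then show ?thesis using True l by (simp add: ennreal_mult'[symmetric])
    qed simp
  qed
  also have "\<dots> = ennreal (4 / l\<^sup>2) * (\<integral>\<^sup>+x. ennreal ((norm (fourier h2 x))\<^sup>2) \<partial>lborel)"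
    by (rule nn_integral_cmult) measurable
  also have "\<dots> \<le> ennreal (4 / l\<^sup>2) * (\<integral>\<^sup>+t. ennreal ((norm (h2 t))\<^sup>2) \<partial>lborel)"
    unfolding h2_def by (intro mult_left_mono plancherel_le int' S') auto
  also have "(\<integral>\<^sup>+t. ennreal ((norm (h2 t))\<^sup>2) \<partial>lborel) = (\<integral>\<^sup>+t. ennreal ((norm (h t))\<^sup>2) * indicator {0<..<2 * G t} l \<partial>lborel)"
    using l by (intro nn_integral_cong) (auto simp: h2_def S_def split: split_indicator)
  finally show ?thesis .
qed

text \<open>The factor \<open>4 * p\<close> comes from Chebyshev and the density
  \<open>p * l powr (p - 1)\<close> of the levels. The factor
  \<open>2 powr (p - 2) / (p - 2)\<close> comes from integrating \<open>l powr (p - 3)\<close> up to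
  \<open>2 * G t\<close>, and the last factor from the two pointwise summands, one of which costs
  Hardy's constant.\<close>

definition hardy_littlewood_const :: "real \<Rightarrow> real" where
  "hardy_littlewood_const p = 4 * p * 2 powr (p - 2) / (p - 2) * (1 + 2 * (2 * p - 1) powr p)"

text \<open>A Hardy-Littlewood inequality for the Fourier transform. The assumption
  \<open>p > 2\<close> makes \<open>l powr (p - 3)\<close> integrable at level 0.\<close>

lemma hardy_littlewood_fourier:
  fixes h :: "real \<Rightarrow> complex"
  assumes h: "integrable lborel h" and h0: "\<And>t. t \<le> 0 \<Longrightarrow> h t = 0" and p: "p > 2"
  shows "(\<integral>\<^sup>+x. ennreal (norm (fourier h x) powr p) \<partial>lborel)
    \<le> ennreal (hardy_littlewood_const p) * (\<integral>\<^sup>+t. ennreal (norm (h t) powr p * t powr (p - 2)) * indicator {0<..} t \<partial>lborel)"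
proof -
  define G where "G t = (\<integral>s. indicator {..t} s *\<^sub>R norm (h s) \<partial>lborel)" for t
  have [measurable]: "h \<in> borel_measurable borel" using h by auto
  have int: "integrable lborel (\<lambda>s. indicator A s *\<^sub>R norm (h s))" if "A \<in> sets borel" for A
    using that h by (intro integrable_mult_indicator) auto
  have "mono G"
    unfolding G_def by (intro monoI integral_mono int) (auto split: split_indicator)
  then have [measurable]: "G \<in> borel_measurable borel" by (rule borel_measurable_mono)
  have G_nonneg: "G t \<ge> 0" for t unfolding G_def by (intro Bochner_Integration.integral_nonneg) auto
  have G_nn: "ennreal (G t) = (\<integral>\<^sup>+s. ennreal (norm (h s)) * indicator {0<..<t} s \<partial>lborel)" for t
  proof -
    have "ennreal (G t) = (\<integral>\<^sup>+s. ennreal (indicator {..t} s *\<^sub>R norm (h s)) \<partial>lborel)"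
      unfolding G_def by (rule nn_integral_eq_integral[symmetric, OF int]) auto
    also have "\<dots> = (\<integral>\<^sup>+s. ennreal (norm (h s)) * indicator {0<..<t} s \<partial>lborel)"
      by (rule nn_integral_cong_AE, use AE_lborel_singleton[of t] in eventually_elim)
        (auto simp: h0 split: split_indicator)
    finally show ?thesis .
  qed
  define N where "N = (\<integral>\<^sup>+t. ennreal (norm (h t) powr p * t powr (p - 2)) * indicator {0<..} t \<partial>lborel)"
  define K where "K = 4 * p * 2 powr (p - 2) / (p - 2)"
  have K: "K \<ge> 0" using p by (simp add: K_def)
  have hardy: "(\<integral>\<^sup>+t. ennreal (G t powr p * t powr (- 2)) * indicator {0<..} t \<partial>lborel)
      \<le> ennreal (2 * (2 * p - 1) powr p) * N"
    unfolding N_def using p G_nonneg G_nn by (intro hardy_inequality) auto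
  have "(\<integral>\<^sup>+x. ennreal (norm (fourier h x) powr p) \<partial>lborel)
     = (\<integral>\<^sup>+x. (\<integral>\<^sup>+l. ennreal (p * l powr (p - 1)) * indicator {0<..<norm (fourier h x)} l \<partial>lborel) \<partial>lborel)"
    using p by (simp add: layer_cake_powr)
  also have "\<dots> = (\<integral>\<^sup>+l. (\<integral>\<^sup>+x. ennreal (p * l powr (p - 1)) * indicator {0<..<norm (fourier h x)} l \<partial>lborel) \<partial>lborel)"
    by (rule lborel_pair.Fubini') (simp add: split_beta' indicator_def)
  also have "\<dots> = (\<integral>\<^sup>+l. ennreal (p * l powr (p - 1)) * (\<integral>\<^sup>+x. indicator {0<..<norm (fourier h x)} l \<partial>lborel) \<partial>lborel)"
    by (intro nn_integral_cong nn_integral_cmult) (simp add: indicator_def)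
  also have "\<dots> \<le> (\<integral>\<^sup>+l. (\<integral>\<^sup>+t. ennreal (4 * p * l powr (p - 3)) * (ennreal ((norm (h t))\<^sup>2) * indicator {0<..<2 * G t} l) \<partial>lborel) \<partial>lborel)"
  proof (rule nn_integral_mono)
    fix l :: real
    show "ennreal (p * l powr (p - 1)) * (\<integral>\<^sup>+x. indicator {0<..<norm (fourier h x)} l \<partial>lborel)
      \<le> (\<integral>\<^sup>+t. ennreal (4 * p * l powr (p - 3)) * (ennreal ((norm (h t))\<^sup>2) * indicator {0<..<2 * G t} l) \<partial>lborel)"
    proof (cases "l > 0")
      case True
      have "p * l powr (p - 1) * (4 / l\<^sup>2) = 4 * p * l powr (p - 3)"
        using True p by (simp add: powr_diff powr_numeral field_simps power2_eq_square power3_eq_cube)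
      then have eq: "ennreal (p * l powr (p - 1)) * ennreal (4 / l\<^sup>2) = ennreal (4 * p * l powr (p - 3))"
        using p by (simp add: ennreal_mult'[symmetric])
      have "ennreal (p * l powr (p - 1)) * (\<integral>\<^sup>+x. indicator {0<..<norm (fourier h x)} l \<partial>lborel)
         \<le> ennreal (p * l powr (p - 1)) * (ennreal (4 / l\<^sup>2) * (\<integral>\<^sup>+t. ennreal ((norm (h t))\<^sup>2) * indicator {0<..<2 * G t} l \<partial>lborel))"
        unfolding G_def by (intro mult_left_mono fourier_distribution_le h True) auto
      also have "\<dots> = (\<integral>\<^sup>+t. ennreal (4 * p * l powr (p - 3)) * (ennreal ((norm (h t))\<^sup>2) * indicator {0<..<2 * G t} l) \<partial>lborel)"
        unfolding mult.assoc[symmetric, of "ennreal (p * l powr (p - 1))"] eq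
        by (rule nn_integral_cmult[symmetric]) (simp add: indicator_def)
      finally show ?thesis .
    qed simp
  qed
  \<comment> \<open>For fixed \<open>t\<close> only the levels below \<open>2 * G t\<close>
    contribute, so the inner integral becomes an explicit power of \<open>G t\<close>.\<close>
  also have "\<dots> = (\<integral>\<^sup>+t. (\<integral>\<^sup>+l. ennreal (4 * p * l powr (p - 3)) * (ennreal ((norm (h t))\<^sup>2) * indicator {0<..<2 * G t} l) \<partial>lborel) \<partial>lborel)"
    by (rule lborel_pair.Fubini') (simp add: split_beta' indicator_def)
  also have "\<dots> = (\<integral>\<^sup>+t. ennreal (K * ((norm (h t))\<^sup>2 * G t powr (p - 2))) \<partial>lborel)"
  proof (rule nn_integral_cong)
    fix t
    have "(\<integral>\<^sup>+l. ennreal (4 * p * l powr (p - 3)) * (ennreal ((norm (h t))\<^sup>2) * indicator {0<..<2 * G t} l) \<partial>lborel)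
       = (\<integral>\<^sup>+l. ennreal (4 * p * (norm (h t))\<^sup>2) * (ennreal (l powr (p - 3)) * indicator {0<..<2 * G t} l) \<partial>lborel)"
      using p by (intro nn_integral_cong) (simp add: ennreal_mult'[symmetric] mult_ac split: split_indicator)
    also have "\<dots> = ennreal (4 * p * (norm (h t))\<^sup>2) * ennreal ((2 * G t) powr (p - 2) / (p - 2))"
      using p G_nonneg[of t] nn_integral_powr_from_0[of "p - 3" "2 * G t"] by (simp add: nn_integral_cmult)
    also have "\<dots> = ennreal (K * ((norm (h t))\<^sup>2 * G t powr (p - 2)))"
      using p G_nonneg[of t] by (simp add: K_def ennreal_mult'[symmetric] powr_mult mult_ac)
    finally show "(\<integral>\<^sup>+l. ennreal (4 * p * l powr (p - 3)) * (ennreal ((norm (h t))\<^sup>2) * indicator {0<..<2 * G t} l) \<partial>lborel)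
       = ennreal (K * ((norm (h t))\<^sup>2 * G t powr (p - 2)))" .
  qed
  also have "\<dots> \<le> (\<integral>\<^sup>+t. ennreal K * (ennreal (norm (h t) powr p * t powr (p - 2)) * indicator {0<..} t
       + ennreal (G t powr p * t powr (- 2)) * indicator {0<..} t) \<partial>lborel)"
  proof (rule nn_integral_mono)
    fix t
    show "ennreal (K * ((norm (h t))\<^sup>2 * G t powr (p - 2))) \<le> ennreal K * (ennreal (norm (h t) powr p * t powr (p - 2)) * indicator {0<..} t
       + ennreal (G t powr p * t powr (- 2)) * indicator {0<..} t)"
    proof (cases "t > 0")
      case True
      \<comment> \<open>After multiplication by \<open>t\<^sup>2\<close> the integrand is
        \<open>a powr 2 * b powr (p - 2)\<close>, which is at most the \<open>p\<close>-th power of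
        the larger of \<open>a\<close> and \<open>b\<close>.\<close>
      define a where "a = norm (h t) * t"
      define b where "b = G t"
      have ab: "a \<ge> 0" "b \<ge> 0" using True G_nonneg by (auto simp: a_def b_def)
      have "a powr 2 * b powr (p - 2) \<le> a powr p + b powr p"
      proof (cases "a \<le> b")
        case True
        then have "a powr 2 * b powr (p - 2) \<le> b powr 2 * b powr (p - 2)"
          using ab by (intro mult_right_mono powr_mono2) auto
        then show ?thesis by (simp add: powr_add[symmetric] add_increasing)
      next
        case False
        then have "a powr 2 * b powr (p - 2) \<le> a powr 2 * a powr (p - 2)"
          using ab p by (intro mult_left_mono powr_mono2) auto
        then show ?thesis by (simp add: powr_add[symmetric] add_increasing2)
      qed
      then have "a powr 2 * b powr (p - 2) * t powr (- 2) \<le> (a powr p + b powr p) * t powr (- 2)"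
        by (intro mult_right_mono) auto
      also have "a powr 2 * b powr (p - 2) * t powr (- 2) = (norm (h t))\<^sup>2 * G t powr (p - 2)"
        using True ab by (simp add: a_def b_def powr_minus powr_mult powr_numeral)
      also have "(a powr p + b powr p) * t powr (- 2) = norm (h t) powr p * t powr (p - 2) + G t powr p * t powr (- 2)"
        using True by (simp add: a_def b_def powr_mult distrib_right mult.assoc powr_add[symmetric])
      finally show ?thesis
        using True K by (simp add: ennreal_mult'[symmetric] ennreal_plus[symmetric] mult_left_mono del: ennreal_plus)
    qed (simp add: h0)
  qed
  also have "\<dots> = ennreal K * (N + (\<integral>\<^sup>+t. ennreal (G t powr p * t powr (- 2)) * indicator {0<..} t \<partial>lborel))"
    unfolding N_def by (simp add: nn_integral_cmult nn_integral_add)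
  also have "\<dots> \<le> ennreal K * (N + ennreal (2 * (2 * p - 1) powr p) * N)"
    by (intro mult_left_mono add_left_mono hardy) auto
  also have "\<dots> = ennreal K * (ennreal (1 + 2 * (2 * p - 1) powr p) * N)"
    by (simp add: distrib_right)
  also have "\<dots> = ennreal (hardy_littlewood_const p) * N"
    unfolding mult.assoc[symmetric] hardy_littlewood_const_def K_def[symmetric] using K by (simp add: ennreal_mult')
  finally show ?thesis by (simp add: N_def)
qed

section \<open>The Laplace transform\<close>

text \<open>Near 0 the weight \<open>t powr (p - 2)\<close> degenerates, and integrability comes
  from the moment bound on \<open>(0, 1)\<close>. For \<open>t \<ge> 1\<close> the weight is at
  least 1, so \<open>u \<le> u powr p + 1\<close> suffices, the constant being absorbed by the
  exponential.\<close>

lemma integrable_exp_decay: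
  fixes u :: "real \<Rightarrow> real"
  assumes [measurable]: "u \<in> borel_measurable borel" and u: "\<And>s. u s \<ge> 0" "\<And>s. s \<le> 0 \<Longrightarrow> u s = 0"
    and p: "p > 2" and c: "c > 0"
    and N: "(\<integral>\<^sup>+s. ennreal (u s powr p * s powr (p - 2)) * indicator {0<..} s \<partial>lborel) < \<infinity>"
  shows "integrable lborel (\<lambda>t. u t * exp (- c * t))"
proof (rule integrableI_bounded)
  have "(\<integral>\<^sup>+t. ennreal (norm (u t * exp (- c * t))) \<partial>lborel)
    \<le> (\<integral>\<^sup>+t. ennreal (u t) * indicator {0<..<1} t
        + (ennreal (u t powr p * t powr (p - 2)) * indicator {0<..} t + ennreal (indicator {1..} t * exp (- c * t))) \<partial>lborel)"
  proof (rule nn_integral_mono)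
    fix t :: real
    consider "t \<le> 0" | "0 < t" "t < 1" | "t \<ge> 1" by linarith
    then show "ennreal (norm (u t * exp (- c * t))) \<le> ennreal (u t) * indicator {0<..<1} t
        + (ennreal (u t powr p * t powr (p - 2)) * indicator {0<..} t + ennreal (indicator {1..} t * exp (- c * t)))"
    proof cases
      case 2
      have "u t * exp (- c * t) \<le> u t" using 2 c u(1)[of t] by (intro mult_left_le) auto
      then show ?thesis using 2 u(1)[of t] by (auto intro!: add_increasing2 ennreal_leI)
    next
      case 3
      have "u t * exp (- c * t) \<le> (u t powr p + 1) * exp (- c * t)"
        using le_powr_mult_add[of "u t" 1 p] u(1)[of t] p by (intro mult_right_mono) auto
      also have "\<dots> \<le> u t powr p * t powr (p - 2) + exp (- c * t)"
      proof -
        have "exp (- c * t) \<le> 1" using 3 c by simp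
        also have "1 \<le> t powr (p - 2)" using 3 p by (intro ge_one_powr_ge_zero) auto
        finally have "u t powr p * exp (- c * t) \<le> u t powr p * t powr (p - 2)"
          by (intro mult_left_mono) auto
        then show ?thesis by (simp add: distrib_right)
      qed
      finally show ?thesis using 3 u(1)[of t]
        by (simp add: ennreal_plus[symmetric] del: ennreal_plus)
    qed (simp add: u(2))
  qed
  also have "\<dots> = (\<integral>\<^sup>+t. ennreal (u t) * indicator {0<..<1} t \<partial>lborel)
      + ((\<integral>\<^sup>+t. ennreal (u t powr p * t powr (p - 2)) * indicator {0<..} t \<partial>lborel)
       + (\<integral>\<^sup>+t. ennreal (indicator {1..} t * exp (- c * t)) \<partial>lborel))"
    by (simp add: nn_integral_add)
  also have "(\<integral>\<^sup>+t. ennreal (indicator {1..} t * exp (- c * t)) \<partial>lborel) = ennreal (exp (- c * 1) / c)"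
    by (rule nn_integral_has_integral_lebesgue[OF _ has_integral_exp_minus_to_infinity[OF c]]) auto
  also have "(\<integral>\<^sup>+t. ennreal (u t) * indicator {0<..<1} t \<partial>lborel)
      + ((\<integral>\<^sup>+t. ennreal (u t powr p * t powr (p - 2)) * indicator {0<..} t \<partial>lborel) + ennreal (exp (- c * 1) / c)) < \<infinity>"
  proof -
    have "hardy_moment p u 1 < \<infinity>"
      using hardy_moment_le[of 1 u p] N by (auto intro: le_less_trans)
    then have "(\<integral>\<^sup>+t. ennreal (u t) * indicator {0<..<1} t \<partial>lborel) < \<infinity>"
      using p by (intro le_less_trans[OF nn_integral_le_hardy_moment[of u p 1 1]]) (auto simp: u)
    then show ?thesis using N by simp
  qed
  finally show "(\<integral>\<^sup>+t. ennreal (norm (u t * exp (- c * t))) \<partial>lborel) < \<infinity>" .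
qed simp

section \<open>Kernel estimates and holomorphy of the Laplace integral\<close>

lemma laplace_kernel_measurable [measurable]: "laplace_kernel z \<in> borel_measurable borel"
  unfolding laplace_kernel_def by (intro borel_measurable_continuous_onI continuous_intros)

lemma norm_laplace_kernel: "norm (laplace_kernel z t) = exp (- (2 * pi * Im z) * t)"
  by (simp add: laplace_kernel_def)

lemma laplace_kernel_Complex:
  "laplace_kernel (Complex x y) t = of_real (exp (- (2 * pi * y) * t)) * cis (2 * pi * t * x)"
  by (simp add: laplace_kernel_def exp_of_real[symmetric] cis_conv_exp exp_add[symmetric] complex_eq_iff Complex_eq algebra_simps)

text \<open>The mean value inequality on a convex closed half-plane. The bound is uniform in
  \<open>z\<close> and \<open>w\<close>, so it dominates all difference quotients at once.\<close>

lemma laplace_kernel_Lipschitz: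
  assumes "t > 0" "y > 0" "Im z \<ge> y" "Im w \<ge> y"
  shows "norm (laplace_kernel w t - laplace_kernel z t) \<le> 2 / y * exp (- (pi * y) * t) * norm (w - z)"
proof -
  have "norm (laplace_kernel w t - laplace_kernel z t) \<le> 2 * pi * t * exp (- (2 * pi * y) * t) * norm (w - z)"
  proof (rule field_differentiable_bound[where S = "{z. Im z \<ge> y}"])
    show "convex {z. Im z \<ge> y}" by (rule convex_halfspace_Im_ge)
    fix v assume "v \<in> {z. Im z \<ge> y}"
    show "((\<lambda>z. laplace_kernel z t) has_field_derivative 2 * of_real pi * \<i> * of_real t * laplace_kernel v t) (at v within {z. Im z \<ge> y})"
      unfolding laplace_kernel_def by (auto intro!: derivative_eq_intros)
    show "norm (2 * of_real pi * \<i> * of_real t * laplace_kernel v t) \<le> 2 * pi * t * exp (- (2 * pi * y) * t)"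
      using assms \<open>v \<in> _\<close> by (simp add: norm_mult norm_laplace_kernel)
  qed (use assms in auto)
  also have "\<dots> \<le> 2 / y * exp (- (pi * y) * t) * norm (w - z)"
  proof (rule mult_right_mono)
    \<comment> \<open>Half of the decay rate \<open>2 * pi * y\<close> is spent on absorbing the
      factor \<open>t\<close> of the derivative.\<close>
    have "pi * y * t \<le> exp (pi * y * t)" using exp_ge_add_one_self[of "pi * y * t"] by linarith
    then have "2 / y * (pi * y * t) * exp (- (2 * pi * y) * t) \<le> 2 / y * exp (pi * y * t) * exp (- (2 * pi * y) * t)"
      using assms by (intro mult_right_mono mult_left_mono) auto
    then show "2 * pi * t * exp (- (2 * pi * y) * t) \<le> 2 / y * exp (- (pi * y) * t)"
      using assms by (simp add: mult_ac exp_add[symmetric])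
  qed auto
  finally show ?thesis .
qed

text \<open>Differentiation under the integral sign: difference quotients converge along every
  sequence by dominated convergence, with the Lipschitz bound times \<open>norm (g t)\<close> as
  majorant.\<close>

lemma laplace_integral_holomorphic:
  fixes g :: "real \<Rightarrow> complex"
  assumes [measurable]: "g \<in> borel_measurable borel" and g0: "\<And>t. t \<le> 0 \<Longrightarrow> g t = 0"
    and decay: "\<And>c. c > 0 \<Longrightarrow> integrable lborel (\<lambda>t. norm (g t) * exp (- c * t))"
  shows "(\<lambda>z. \<integral>t. g t * laplace_kernel z t \<partial>lborel) holomorphic_on {z. Im z > 0}"
proof (rule holomorphic_onI)
  fix z assume "z \<in> {z. Im z > 0}"
  then have z: "Im z > 0" by simp
  define L where "L w = (\<integral>t. g t * laplace_kernel w t \<partial>lborel)" for w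
  \<comment> \<open>Half the height of \<open>z\<close>, so that the ball of radius \<open>y\<close>
    around \<open>z\<close> stays above height \<open>y\<close>.\<close>
  define y where "y = Im z / 2"
  have y: "y > 0" using z by (simp add: y_def)
  define D where "D t = g t * (2 * of_real pi * \<i> * of_real t * laplace_kernel z t)" for t
  have int: "integrable lborel (\<lambda>t. g t * laplace_kernel w t)" if "Im w > 0" for w
    by (rule Bochner_Integration.integrable_bound[OF decay[of "2 * pi * Im w"]])
      (use that in \<open>auto simp: norm_mult norm_laplace_kernel\<close>)
  have B: "Im w \<ge> y" if "w \<in> ball z y" for w
    using that abs_Im_le_cmod[of "z - w"] by (auto simp: dist_norm y_def)
  have "((\<lambda>w. (L w - L z) / (w - z)) \<longlongrightarrow> (\<integral>t. D t \<partial>lborel)) (at z within ball z y)"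
    unfolding tendsto_at_iff_sequentially
  proof (intro allI impI)
    fix X :: "nat \<Rightarrow> complex" assume X: "\<forall>i. X i \<in> ball z y - {z}" "X \<longlonglongrightarrow> z"
    have XB: "Im (X i) \<ge> y" "Im (X i) > 0" for i using B[of "X i"] X(1) y by (auto intro: less_le_trans)
    have "(\<lambda>i. \<integral>t. g t * ((laplace_kernel (X i) t - laplace_kernel z t) / (X i - z)) \<partial>lborel) \<longlonglongrightarrow> (\<integral>t. D t \<partial>lborel)"
    proof (rule integral_dominated_convergence[where w="\<lambda>t. 2 / y * (norm (g t) * exp (- (pi * y) * t))"])
      show "integrable lborel (\<lambda>t. 2 / y * (norm (g t) * exp (- (pi * y) * t)))"
        using y by (intro integrable_mult_right decay) auto
      show "AE t in lborel. (\<lambda>i. g t * ((laplace_kernel (X i) t - laplace_kernel z t) / (X i - z))) \<longlonglongrightarrow> D t"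
      proof (intro AE_I2)
        fix t
        have "((\<lambda>z. laplace_kernel z t) has_field_derivative 2 * of_real pi * \<i> * of_real t * laplace_kernel z t) (at z)"
          unfolding laplace_kernel_def by (auto intro!: derivative_eq_intros)
        then have "((\<lambda>w. (laplace_kernel w t - laplace_kernel z t) / (w - z)) \<longlongrightarrow> 2 * of_real pi * \<i> * of_real t * laplace_kernel z t) (at z)"
          by (simp add: has_field_derivative_iff)
        then show "(\<lambda>i. g t * ((laplace_kernel (X i) t - laplace_kernel z t) / (X i - z))) \<longlonglongrightarrow> D t"
          using X unfolding D_def tendsto_at_iff_sequentially comp_def by (intro tendsto_mult_left) auto
      qed
      show "AE t in lborel. norm (g t * ((laplace_kernel (X i) t - laplace_kernel z t) / (X i - z)))
          \<le> 2 / y * (norm (g t) * exp (- (pi * y) * t))" for i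
      proof (intro AE_I2)
        fix t
        show "norm (g t * ((laplace_kernel (X i) t - laplace_kernel z t) / (X i - z)))
          \<le> 2 / y * (norm (g t) * exp (- (pi * y) * t))"
        proof (cases "t > 0")
          case True
          have ne: "norm (X i - z) > 0" using X(1) by auto
          have "norm (laplace_kernel (X i) t - laplace_kernel z t) \<le> 2 / y * exp (- (pi * y) * t) * norm (X i - z)"
            using True y z XB by (intro laplace_kernel_Lipschitz) (auto simp: y_def)
          then have "norm (laplace_kernel (X i) t - laplace_kernel z t) / norm (X i - z) \<le> 2 / y * exp (- (pi * y) * t)"
            using ne by (simp add: pos_divide_le_eq)
          then have "norm (g t) * (norm (laplace_kernel (X i) t - laplace_kernel z t) / norm (X i - z)) \<le> norm (g t) * (2 / y * exp (- (pi * y) * t))"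
            by (intro mult_left_mono) auto
          then show ?thesis by (simp add: norm_mult norm_divide mult_ac)
        qed (simp add: g0)
      qed
    qed (auto simp: D_def[abs_def])
    also have "(\<lambda>i. \<integral>t. g t * ((laplace_kernel (X i) t - laplace_kernel z t) / (X i - z)) \<partial>lborel)
        = (\<lambda>i. (L (X i) - L z) / (X i - z))"
    proof
      fix i
      have "(\<integral>t. g t * ((laplace_kernel (X i) t - laplace_kernel z t) / (X i - z)) \<partial>lborel)
         = (\<integral>t. (g t * laplace_kernel (X i) t - g t * laplace_kernel z t) / (X i - z) \<partial>lborel)"
        by (simp add: algebra_simps)
      also have "\<dots> = (L (X i) - L z) / (X i - z)"
        unfolding L_def integral_divide_zero by (simp add: int XB z)
      finally show "(\<integral>t. g t * ((laplace_kernel (X i) t - laplace_kernel z t) / (X i - z)) \<partial>lborel)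
        = (L (X i) - L z) / (X i - z)" .
    qed
    finally show "((\<lambda>w. (L w - L z) / (w - z)) \<circ> X) \<longlonglongrightarrow> (\<integral>t. D t \<partial>lborel)"
      by (simp add: comp_def)
  qed
  then have "(L has_field_derivative (\<integral>t. D t \<partial>lborel)) (at z)"
    using y by (simp add: has_field_derivative_iff at_within_open[of z "ball z y"])
  then show "(\<lambda>z. \<integral>t. g t * laplace_kernel z t \<partial>lborel) field_differentiable at z within {z. Im z > 0}"
    unfolding L_def[symmetric] by (meson field_differentiable_at_within field_differentiable_def)
qed

section \<open>Passage from Lebesgue measurable to Borel functions\<close>

lemma lebesgue_on_Ioi_borel_representative:
  fixes f :: "real \<Rightarrow> complex"
  assumes f: "f \<in> borel_measurable (lebesgue_on {0<..})"
  obtains g where "g \<in> borel_measurable borel" "\<And>t. t \<le> 0 \<Longrightarrow> g t = 0"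
    "AE t in lebesgue. indicator {0<..} t *\<^sub>R f t = g t"
proof -
  define f0 where "f0 t = indicator {0<..} t *\<^sub>R f t" for t
  have f0: "f0 \<in> borel_measurable lebesgue"
    using f unfolding f0_def by (subst (asm) borel_measurable_restrict_space_iff) auto
  \<comment> \<open>The existence of a Borel version is applied to real functions, hence to the real
    and imaginary parts separately.\<close>
  have "(\<lambda>t. Re (f0 t)) \<in> borel_measurable lebesgue" "(\<lambda>t. Im (f0 t)) \<in> borel_measurable lebesgue"
    using f0 by measurable
  then obtain a b where [measurable]: "a \<in> borel_measurable lborel" "b \<in> borel_measurable lborel"
    and ab: "AE t in lborel. Re (f0 t) = a t" "AE t in lborel. Im (f0 t) = b t"
    by (metis completion_ex_borel_measurable_real)
  define g where "g t = indicator {0<..} t *\<^sub>R Complex (a t) (b t)" for t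
  show ?thesis
  proof (rule that)
    have "g = (\<lambda>t. indicator {0<..} t *\<^sub>R (of_real (a t) + \<i> * of_real (b t)))"
      by (auto simp: g_def complex_eq_iff)
    also have "\<dots> \<in> borel_measurable borel" by measurable
    finally show "g \<in> borel_measurable borel" .
    show "AE t in lebesgue. indicator {0<..} t *\<^sub>R f t = g t"
      by (rule AE_completion, use ab in eventually_elim)
        (auto simp: g_def f0_def complex_eq_iff split: split_indicator_asm)
  qed (simp add: g_def)
qed

text \<open>The analysis above takes place over \<open>lborel\<close>, where Fubini's theorem is
  applied. These three identities carry it over to \<open>f\<close>: extending by zero and changing
  values on a null set affects neither the integrals nor integrability.\<close>

lemma laplace_borel_representative:
  assumes f: "f \<in> borel_measurable (lebesgue_on {0<..})"
    and [measurable]: "g \<in> borel_measurable borel"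
    and ae: "AE t in lebesgue. indicator {0<..} t *\<^sub>R f t = g t"
  shows integrable_laplace_borel_iff: "integrable (lebesgue_on {0<..}) (\<lambda>t. f t * laplace_kernel z t)
      \<longleftrightarrow> integrable lborel (\<lambda>t. g t * laplace_kernel z t)" (is ?A)
    and laplace_eq_borel: "laplace f z = (\<integral>t. g t * laplace_kernel z t \<partial>lborel)" (is ?B)
    and power_weight_eq_borel: "(\<integral>\<^sup>+t. ennreal (norm (f t) powr p) \<partial>power_weight a)
      = (\<integral>\<^sup>+t. ennreal (norm (g t) powr p * t powr a) * indicator {0<..} t \<partial>lborel)" (is ?C)
proof -
  have [measurable]: "(\<lambda>t. indicator {0<..} t *\<^sub>R f t) \<in> borel_measurable lebesgue"
    using f by (subst (asm) borel_measurable_restrict_space_iff) auto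
  have k[measurable]: "laplace_kernel z \<in> borel_measurable lebesgue"
    by (rule measurable_completion) simp
  have g[measurable]: "g \<in> borel_measurable lebesgue"
    by (rule measurable_completion) simp
  have ae': "AE t in lebesgue. indicator {0<..} t *\<^sub>R (f t * laplace_kernel z t) = g t * laplace_kernel z t"
    using ae by eventually_elim (auto split: split_indicator)
  have m: "(\<lambda>t. indicator {0<..} t *\<^sub>R (f t * laplace_kernel z t)) \<in> borel_measurable lebesgue"
    by (simp only: mult_scaleR_left[symmetric]) measurable
  have "integrable (lebesgue_on {0<..}) (\<lambda>t. f t * laplace_kernel z t)
     \<longleftrightarrow> integrable lebesgue (\<lambda>t. indicator {0<..} t *\<^sub>R (f t * laplace_kernel z t))"
    by (rule integrable_restrict_space) auto
  also have "\<dots> \<longleftrightarrow> integrable lebesgue (\<lambda>t. g t * laplace_kernel z t)"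
    by (rule integrable_cong_AE[OF m _ ae']) measurable
  also have "\<dots> \<longleftrightarrow> integrable lborel (\<lambda>t. g t * laplace_kernel z t)"
    by (rule integrable_completion) measurable
  finally show ?A .
  have "laplace f z = (\<integral>t. indicator {0<..} t *\<^sub>R (f t * laplace_kernel z t) \<partial>lebesgue)"
    unfolding laplace_def by (rule integral_restrict_space) auto
  also have "\<dots> = (\<integral>t. g t * laplace_kernel z t \<partial>lebesgue)"
    by (rule integral_cong_AE[OF m _ ae']) measurable
  also have "\<dots> = (\<integral>t. g t * laplace_kernel z t \<partial>lborel)"
    by (rule integral_completion) measurable
  finally show ?B .
  have pm: "(\<lambda>t. ennreal (t powr a)) \<in> borel_measurable (lebesgue_on {0<..})"
    by (intro measurable_restrict_space1 measurable_completion) measurable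
  have "(\<integral>\<^sup>+t. ennreal (norm (f t) powr p) \<partial>power_weight a)
     = (\<integral>\<^sup>+t. ennreal (t powr a) * ennreal (norm (f t) powr p) \<partial>lebesgue_on {0<..})"
    unfolding power_weight_def using f by (intro nn_integral_density pm) measurable
  also have "\<dots> = (\<integral>\<^sup>+t. (ennreal (t powr a) * ennreal (norm (f t) powr p)) * indicator {0<..} t \<partial>lebesgue)"
    by (rule nn_integral_restrict_space) auto
  also have "\<dots> = (\<integral>\<^sup>+t. ennreal (norm (g t) powr p * t powr a) * indicator {0<..} t \<partial>lebesgue)"
    by (rule nn_integral_cong_AE, use ae in eventually_elim)
      (auto simp: ennreal_mult'[symmetric] mult.commute split: split_indicator)
  finally show ?C by (simp add: nn_integral_completion)
qed

lemma ennreal_powr_le_mult: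
  assumes "A \<le> ennreal K * B" "K \<ge> 0" "a > 0"
  shows "ennreal_powr A a \<le> ennreal (K powr a) * ennreal_powr B a"
proof (cases "B = \<infinity>")
  case True
  then show ?thesis
    \<comment> \<open>For \<open>K = 0\<close> the convention that 0 times infinity is 0 forces
      \<open>A = 0\<close>; for \<open>K > 0\<close> the right-hand side is infinite.\<close>
    using assms by (cases "K = 0") (auto simp: ennreal_powr_def ennreal_mult_top)
next
  case False
  then obtain b where b: "B = ennreal b" "b \<ge> 0" by (cases B) auto
  have "ennreal K * B = ennreal (K * b)" using assms b by (simp add: ennreal_mult')
  then obtain r where r: "A = ennreal r" "r \<ge> 0" "r \<le> K * b"
    using assms b by (cases A) (auto simp: top_unique)
  have "r powr a \<le> K powr a * b powr a"
    using r b assms by (simp add: powr_mult[symmetric] powr_mono2)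
  then show ?thesis using r b by (simp add: ennreal_powr_def ennreal_mult'[symmetric])
qed

theorem theorem1p6:
  fixes p :: real
  assumes "2 < p"
  shows "\<exists>C::real. C > 0 \<and>
    (\<forall>f \<in> Lp_space p (power_weight (p - 2)).
       (\<forall>z \<in> upper_half_plane.
          integrable (lebesgue_on {0<..}) (\<lambda>t. f t * laplace_kernel z t)) \<and>
       laplace f \<in> hardy_space p \<and>
       hardy_norm p (laplace f) \<le> ennreal C * Lp_norm p (power_weight (p - 2)) f)"
proof (intro exI conjI ballI)
  define K where "K = hardy_littlewood_const p"
  have K: "K > 0" using assms unfolding K_def hardy_littlewood_const_def by (intro mult_pos_pos divide_pos_pos add_pos_nonneg) auto
  \<comment> \<open>The witness is the \<open>p\<close>-th root of the constant in the inequality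
    between \<open>p\<close>-th powers.\<close>
  then show "K powr (1 / p) > 0" by simp
  fix f assume "f \<in> Lp_space p (power_weight (p - 2))"
  then have f: "f \<in> borel_measurable (lebesgue_on {0<..})"
    and fin: "Lp_norm p (power_weight (p - 2)) f < \<infinity>"
    by (auto simp: Lp_space_def power_weight_def)
  from f obtain g where g[measurable]: "g \<in> borel_measurable borel" and g0: "\<And>t. t \<le> 0 \<Longrightarrow> g t = 0"
    and ae: "AE t in lebesgue. indicator {0<..} t *\<^sub>R f t = g t"
    by (rule lebesgue_on_Ioi_borel_representative) blast
  define N where "N = (\<integral>\<^sup>+t. ennreal (norm (g t) powr p * t powr (p - 2)) * indicator {0<..} t \<partial>lborel)"
  have Lp: "Lp_norm p (power_weight (p - 2)) f = ennreal_powr N (1 / p)"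
    unfolding Lp_norm_def N_def using power_weight_eq_borel[OF f g ae] by simp
  have "N < \<infinity>"
    using fin unfolding Lp by (auto simp: ennreal_powr_def less_top split: if_splits)
  then have decay: "integrable lborel (\<lambda>t. norm (g t) * exp (- c * t))" if "c > 0" for c
    using that assms unfolding N_def by (intro integrable_exp_decay) (auto simp: g0)
  have int: "integrable lborel (\<lambda>t. g t * laplace_kernel z t)" if "Im z > 0" for z
    by (rule Bochner_Integration.integrable_bound[OF decay[of "2 * pi * Im z"]])
      (use that in \<open>auto simp: norm_mult norm_laplace_kernel\<close>)
  show "integrable (lebesgue_on {0<..}) (\<lambda>t. f t * laplace_kernel z t)" if "z \<in> upper_half_plane" for z
    unfolding integrable_laplace_borel_iff[OF f g ae] using that by (intro int) (simp add: upper_half_plane_def)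
  have lap: "laplace f = (\<lambda>z. \<integral>t. g t * laplace_kernel z t \<partial>lborel)"
    using laplace_eq_borel[OF f g ae] by auto
  have bound: "hardy_norm p (laplace f) \<le> ennreal (K powr (1 / p)) * Lp_norm p (power_weight (p - 2)) f"
    unfolding hardy_norm_def
  proof (rule SUP_least)
    fix y :: real assume "y \<in> {0<..}"
    then have y: "y > 0" by simp
    define h where "h t = g t * of_real (exp (- (2 * pi * y) * t))" for t
    have [measurable]: "h \<in> borel_measurable borel" unfolding h_def by measurable
    have h: "integrable lborel h"
      by (rule Bochner_Integration.integrable_bound[OF decay[of "2 * pi * y"]])
        (use y in \<open>auto simp: h_def norm_mult\<close>)
    have eq: "laplace f (Complex x y) = fourier h x" for x
      unfolding lap fourier_def h_def laplace_kernel_Complex by (simp add: mult.assoc)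
    have "(\<integral>\<^sup>+x. ennreal (norm (laplace f (Complex x y)) powr p) \<partial>lebesgue)
        = (\<integral>\<^sup>+x. ennreal (norm (fourier h x) powr p) \<partial>lborel)"
      unfolding eq by (simp add: nn_integral_completion)
    also have "\<dots> \<le> ennreal K * (\<integral>\<^sup>+t. ennreal (norm (h t) powr p * t powr (p - 2)) * indicator {0<..} t \<partial>lborel)"
      unfolding K_def by (rule hardy_littlewood_fourier[OF h]) (use assms in \<open>auto simp: h_def g0\<close>)
    \<comment> \<open>Damping only decreases the modulus of \<open>g\<close>, so the bound does not
      depend on \<open>y\<close> and passes to the supremum.\<close>
    also have "\<dots> \<le> ennreal K * N"
      unfolding N_def
    proof (intro mult_left_mono nn_integral_mono)
      fix t
      have "norm (h t) powr p \<le> norm (g t) powr p" if "t > 0"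
        using that y assms by (intro powr_mono2) (auto simp: h_def norm_mult intro!: mult_left_le)
      then show "ennreal (norm (h t) powr p * t powr (p - 2)) * indicator {0<..} t
          \<le> ennreal (norm (g t) powr p * t powr (p - 2)) * indicator {0<..} t"
        by (auto intro!: ennreal_leI mult_right_mono split: split_indicator)
    qed simp
    finally have "ennreal_powr (\<integral>\<^sup>+x. ennreal (norm (laplace f (Complex x y)) powr p) \<partial>lebesgue) (1 / p)
        \<le> ennreal (K powr (1 / p)) * ennreal_powr N (1 / p)"
      using K assms by (intro ennreal_powr_le_mult) auto
    then show "Lp_norm p lebesgue (\<lambda>x. laplace f (Complex x y))
        \<le> ennreal (K powr (1 / p)) * Lp_norm p (power_weight (p - 2)) f"
      unfolding Lp by (simp add: Lp_norm_def)
  qed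
  then show "hardy_norm p (laplace f) \<le> ennreal (K powr (1 / p)) * Lp_norm p (power_weight (p - 2)) f" .
  have "ennreal (K powr (1 / p)) * Lp_norm p (power_weight (p - 2)) f < \<infinity>"
    using fin by (simp add: ennreal_mult_less_top)
  with bound have "hardy_norm p (laplace f) < \<infinity>" by (rule le_less_trans)
  moreover have "laplace f holomorphic_on upper_half_plane"
    unfolding lap upper_half_plane_def by (rule laplace_integral_holomorphic[OF g g0 decay])
  ultimately show "laplace f \<in> hardy_space p" by (simp add: hardy_space_def)
qed

end
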